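(* Let $z\in\mathbb C$ and $\alpha=\sqrt z$. For $|x|<1$, define $$\mathcal O_4(z,x):=\sum_{n=0}^{\infty}\frac{\binom{4n}{2n}}{16^n(2n+1)}\prod_{j=1}^{n}\left(1+\frac{z}{(2j-1)^2}\right)x^{2n+1}.$$ Then $$\mathcal O_4(z,x)=x\,{}_4F_3\left(\begin{matrix}1/4,\,3/4,\,1/2+i\alpha/2,\,1/2-i\alpha/2\\ 1/2,\,1/2,\,3/2\end{matrix};x^2\right).$$ For $$\mathcal E_4(z,x):=\sum_{n=1}^{\infty}\frac{16^n}{n^2\binom{4n}{2n}}\prod_{j=1}^{n-1}\left(1+\frac{z}{j^2}\right)x^{2n}\qquad(|x|<1),$$ one has $$\mathcal E_4(z,x)=\frac83x^2\,{}_4F_3\left(\begin{matrix}1,\,3/2,\,1+i\alpha,\,1-i\alpha\\ 2,\,5/4,\,7/4\end{matrix};x^2\right).$$ Moreover, with $\mathcal O_4(0,1)$ denoting the value of the series at $z=0$, $x=1$, $$\mathcal O_4(0,1)=\sum_{n=0}^{\infty}\frac{\binom{4n}{2n}}{16^n(2n+1)}=\sqrt2.$$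
   Context: ${}_4F_3$ is the generalized hypergeometric series ${}_4F_3\left(\begin{matrix}a_1,a_2,a_3,a_4\\[2pt] {b_1},b_2,b_3\end{matrix};y\right)=\sum_{n\ge0}\frac{(a_1)_n(a_2)_n(a_3)_n(a_4)_n}{(b_1)_n(b_2)_n(b_3)_n}\frac{y^n}{n!}$, with $(a)_n=a(a+1)\cdots(a+n-1)$. *)

theory Defs
  imports Complex_Main
begin

definition hypergeo_4F3_term ::
  "complex \<Rightarrow> complex \<Rightarrow> complex \<Rightarrow> complex \<Rightarrow> complex \<Rightarrow> complex \<Rightarrow> complex \<Rightarrow> complex \<Rightarrow> nat \<Rightarrow> complex" where
  "hypergeo_4F3_term a1 a2 a3 a4 b1 b2 b3 y n =
     (pochhammer a1 n * pochhammer a2 n * pochhammer a3 n * pochhammer a4 n) /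
     (pochhammer b1 n * pochhammer b2 n * pochhammer b3 n) * (y ^ n / fact n)"

definition hypergeo_4F3 ::
  "complex \<Rightarrow> complex \<Rightarrow> complex \<Rightarrow> complex \<Rightarrow> complex \<Rightarrow> complex \<Rightarrow> complex \<Rightarrow> complex \<Rightarrow> complex" where
  "hypergeo_4F3 a1 a2 a3 a4 b1 b2 b3 y = (\<Sum>n. hypergeo_4F3_term a1 a2 a3 a4 b1 b2 b3 y n)"

definition O4_term :: "complex \<Rightarrow> complex \<Rightarrow> nat \<Rightarrow> complex" where
  "O4_term z x n =
     of_nat ((4 * n) choose (2 * n)) / (16 ^ n * (2 * of_nat n + 1)) *
     (\<Prod>j=1..n. 1 + z / (2 * of_nat j - 1)\<^sup>2) * x ^ (2 * n + 1)"

definition O4 :: "complex \<Rightarrow> complex \<Rightarrow> complex" where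
  "O4 z x = (\<Sum>n. O4_term z x n)"

(* Only the values at n >= 1 are used. *)
definition E4_term :: "complex \<Rightarrow> complex \<Rightarrow> nat \<Rightarrow> complex" where
  "E4_term z x n =
     16 ^ n / ((of_nat n)\<^sup>2 * of_nat ((4 * n) choose (2 * n))) *
     (\<Prod>j=1..n - 1. 1 + z / (of_nat j)\<^sup>2) * x ^ (2 * n)"

(* The series starts at n = 1, whence the shift by Suc. *)
definition E4 :: "complex \<Rightarrow> complex \<Rightarrow> complex" where
  "E4 z x = (\<Sum>n. E4_term z x (Suc n))"

end

theory Submission
  imports Defs "HOL-Computational_Algebra.Formal_Power_Series"
begin

text \<open>
  The two hypergeometric identities hold term by term, by the duplication formula
  for Pochhammer symbols. For the value \<open>\<surd>2\<close>, the summand is twice the coefficient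
  of \<open>y ^ (2 * n + 1)\<close> in the binomial series \<open>S y\<close> of \<open>(1 + y) powr (1/2)\<close>, so the sum
  equals \<open>S 1 - S (-1)\<close>. The series converges absolutely at \<open>y = \<plusminus>1\<close>, so Vandermonde's
  identity gives \<open>(S y)\<^sup>2 = 1 + y\<close> there.
\<close>

section \<open>Pochhammer symbols\<close>

lemma pochhammer_nonzero_of_Re_pos:
  fixes c :: complex
  assumes "Re c > 0"
  shows "pochhammer c n \<noteq> 0"
proof
  assume "pochhammer c n = 0"
  then obtain k where "c = - of_nat k"
    by (auto simp: pochhammer_eq_0_iff)
  with assms show False by simp
qed

text \<open>Over the complex numbers \<open>u\<^sup>2 + \<beta>\<^sup>2\<close> splits as
  \<open>(u + \<i> * \<beta>) * (u - \<i> * \<beta>)\<close>, which produces the two upper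
  parameters involving \<alpha>. The odd series uses \<open>c = 1/2\<close> with
  \<open>\<beta> = \<alpha> / 2\<close>, the even one \<open>c = 1\<close> with
  \<open>\<beta> = \<alpha>\<close>.\<close>

lemma prod_one_plus_eq_pochhammer:
  fixes c \<beta> :: complex
  assumes "Re c > 0"
  shows "(\<Prod>j=1..n. 1 + \<beta>\<^sup>2 / (c + of_nat j - 1)\<^sup>2) =
    pochhammer (c + \<i> * \<beta>) n * pochhammer (c - \<i> * \<beta>) n / (pochhammer c n)\<^sup>2"
proof (induction n)
  case (Suc n)
  have nz: "c + of_nat n \<noteq> 0"
    using assms by (auto simp: complex_eq_iff)
  have "1 + \<beta>\<^sup>2 / (c + of_nat n)\<^sup>2 =
      (c + \<i> * \<beta> + of_nat n) * (c - \<i> * \<beta> + of_nat n) / (c + of_nat n)\<^sup>2"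
  proof -
    have "(c + \<i> * \<beta> + of_nat n) * (c - \<i> * \<beta> + of_nat n) = (c + of_nat n)\<^sup>2 + \<beta>\<^sup>2"
      by (simp add: algebra_simps power2_eq_square)
    with nz show ?thesis by (simp add: add_divide_distrib)
  qed
  with Suc show ?case
    by (simp add: pochhammer_Suc power2_eq_square mult_ac)
qed simp

lemma central_binomial_pochhammer:
  "of_nat ((2 * k) choose k) = (4 ^ k * pochhammer (1/2) k / fact k :: 'a :: field_char_0)"
  using fact_double[of k, where 'a = 'a]
  by (simp add: binomial_fact power_mult)

text \<open>Duplication is applied twice: once inside the central binomial coefficient, then to
  split \<open>pochhammer (1/2) (2 * n)\<close> into the parameters 1/4 and 3/4.\<close>

lemma binomial_4n_2n_pochhammer:
  "of_nat ((4 * n) choose (2 * n)) =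
    (16 ^ n * pochhammer (1/4) n * pochhammer (3/4) n / (fact n * pochhammer (1/2) n)
      :: 'a :: field_char_0)"
proof -
  have "of_nat ((4 * n) choose (2 * n)) =
      (4 ^ (2 * n) * pochhammer (1/2) (2 * n) / fact (2 * n) :: 'a)"
    using central_binomial_pochhammer[of "2 * n", where 'a = 'a] by simp
  also have "pochhammer (1/2) (2 * n) = (4 ^ n * pochhammer (1/4) n * pochhammer (3/4) n :: 'a)"
    using pochhammer_double[of "1/4 :: 'a" n] by (simp add: power_mult)
  also have "fact (2 * n) = (4 ^ n * pochhammer (1/2) n * fact n :: 'a)"
    using fact_double[of n, where 'a = 'a] by (simp add: power_mult)
  also have "4 ^ (2 * n) = (16 ^ n :: 'a)"
    by (simp add: power_mult)
  finally show ?thesis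
    by (simp add: mult_ac)
qed

section \<open>Convergence of the hypergeometric series\<close>

lemma tendsto_shift_quotient:
  fixes a b :: complex
  shows "(\<lambda>n. (a + of_nat n) / (b + of_nat n)) \<longlonglongrightarrow> 1"
proof -
  have inv: "(\<lambda>n. inverse (of_nat n :: complex)) \<longlonglongrightarrow> 0"
    by (rule lim_inverse_n)
  have "(\<lambda>n. (a * inverse (of_nat n) + 1) / (b * inverse (of_nat n) + 1)) \<longlonglongrightarrow> (a * 0 + 1) / (b * 0 + 1)"
    by (intro tendsto_intros inv) auto
  moreover have "eventually (\<lambda>n. (a * inverse (of_nat n) + 1) / (b * inverse (of_nat n) + 1) =
      (a + of_nat n) / (b + of_nat n)) sequentially"
    using eventually_gt_at_top[of 0]
  proof eventually_elim
    case (elim n)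
    have "a * inverse (of_nat n) + 1 = (a + of_nat n) / of_nat n"
      "b * inverse (of_nat n) + 1 = (b + of_nat n) / of_nat n"
      using elim by (simp_all add: field_simps)
    with elim show ?case by simp
  qed
  ultimately show ?thesis
    by (simp add: tendsto_cong)
qed

text \<open>If a lower factor such as \<open>b1 + of_nat n\<close> vanishes, both sides are 0
  because \<open>x / 0 = 0\<close>.\<close>

lemma hypergeo_4F3_term_Suc:
  "hypergeo_4F3_term a1 a2 a3 a4 b1 b2 b3 y (Suc n) =
    ((a1 + of_nat n) / (b1 + of_nat n)) * ((a2 + of_nat n) / (b2 + of_nat n)) *
    ((a3 + of_nat n) / (b3 + of_nat n)) * ((a4 + of_nat n) / (1 + of_nat n)) * y *
    hypergeo_4F3_term a1 a2 a3 a4 b1 b2 b3 y n"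
  by (simp add: hypergeo_4F3_term_def pochhammer_Suc mult_ac)

text \<open>Ratio test: upper and lower parameters, with the factorial as a fourth lower one, pair
  into quotients tending to 1, so the term ratio tends to \<open>y\<close>.\<close>

lemma summable_hypergeo_4F3_term:
  assumes "norm y < 1"
  shows "summable (hypergeo_4F3_term a1 a2 a3 a4 b1 b2 b3 y)"
proof -
  define R where "R n = ((a1 + of_nat n) / (b1 + of_nat n)) * ((a2 + of_nat n) / (b2 + of_nat n)) *
    ((a3 + of_nat n) / (b3 + of_nat n)) * ((a4 + of_nat n) / (1 + of_nat n)) * y" for n
  have "(\<lambda>n. norm (R n)) \<longlonglongrightarrow> norm (1 * 1 * 1 * 1 * y)"
    unfolding R_def by (intro tendsto_intros tendsto_shift_quotient)
  moreover obtain c where c: "norm y < c" "c < 1"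
    using assms dense by blast
  ultimately have "eventually (\<lambda>n. norm (R n) < c) sequentially"
    by (intro order_tendstoD) auto
  then obtain N where N: "norm (R n) < c" if "n \<ge> N" for n
    by (auto simp: eventually_sequentially)
  show ?thesis
  proof (rule summable_ratio_test[OF c(2)])
    fix n assume "n \<ge> N"
    then show "norm (hypergeo_4F3_term a1 a2 a3 a4 b1 b2 b3 y (Suc n)) \<le>
        c * norm (hypergeo_4F3_term a1 a2 a3 a4 b1 b2 b3 y n)"
      using N[of n]
      by (simp only: hypergeo_4F3_term_Suc R_def[symmetric] norm_mult) (simp add: mult_right_mono)
  qed
qed

section \<open>Termwise identification\<close>

lemma O4_term_eq:
  assumes "\<alpha>\<^sup>2 = z"
  shows "O4_term z x n =
    x * hypergeo_4F3_term (1/4) (3/4) (1/2 + \<i> * \<alpha> / 2) (1/2 - \<i> * \<alpha> / 2) (1/2) (1/2) (3/2) (x\<^sup>2) n"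
proof -
  have "(\<Prod>j=1..n. 1 + z / (2 * of_nat j - 1)\<^sup>2) =
      (\<Prod>j=1..n. 1 + (\<alpha> / 2)\<^sup>2 / (1/2 + of_nat j - 1)\<^sup>2)"
  proof (rule prod.cong[OF refl])
    fix j :: nat
    have "(2 * of_nat j - 1 :: complex) = 2 * (1/2 + of_nat j - 1)"
      by simp
    then show "1 + z / (2 * of_nat j - 1)\<^sup>2 = 1 + (\<alpha> / 2)\<^sup>2 / (1/2 + of_nat j - 1)\<^sup>2"
      by (simp only: power_mult_distrib power_divide assms) simp
  qed
  also have "\<dots> = pochhammer (1/2 + \<i> * \<alpha> / 2) n * pochhammer (1/2 - \<i> * \<alpha> / 2) n / (pochhammer (1/2) n)\<^sup>2"
    by (subst prod_one_plus_eq_pochhammer) simp_all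
  finally have prod: "(\<Prod>j=1..n. 1 + z / (2 * of_nat j - 1)\<^sup>2) = \<dots>" .
  \<comment> \<open>Three factors \<open>pochhammer (1/2) n\<close> stand in the denominator, one
    from the binomial and two from the product. The factor \<open>2 * of_nat n + 1\<close> turns one
    of them into the lower parameter 3/2.\<close>
  have "pochhammer (1/2) n * (2 * of_nat n + 1) = (pochhammer (3/2) n :: complex)"
    using pochhammer_rec[of "1/2 :: complex" n] pochhammer_Suc[of "1/2 :: complex" n]
    by (simp add: algebra_simps)
  moreover have "(2 * of_nat n + 1 :: complex) \<noteq> 0"
    by (metis of_nat_Suc of_nat_mult of_nat_numeral of_nat_neq_0 add.commute)
  moreover have "pochhammer (1/2 :: complex) n \<noteq> 0"
    by (rule pochhammer_nonzero_of_Re_pos) simp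
  ultimately show ?thesis
    unfolding O4_term_def hypergeo_4F3_term_def prod binomial_4n_2n_pochhammer
    by (simp add: power_mult power2_eq_square divide_simps)
qed

lemma E4_term_Suc_eq:
  assumes "\<alpha>\<^sup>2 = z"
  shows "E4_term z x (Suc n) =
    8/3 * x\<^sup>2 * hypergeo_4F3_term 1 (3/2) (1 + \<i> * \<alpha>) (1 - \<i> * \<alpha>) 2 (5/4) (7/4) (x\<^sup>2) n"
proof -
  have prod: "(\<Prod>j=1..n. 1 + z / (of_nat j)\<^sup>2) =
      pochhammer (1 + \<i> * \<alpha>) n * pochhammer (1 - \<i> * \<alpha>) n / (fact n)\<^sup>2"
    using prod_one_plus_eq_pochhammer[of 1 \<alpha> n] by (simp add: assms pochhammer_fact)
  have two: "pochhammer 2 n = (of_nat (Suc n) * fact n :: complex)"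
    using pochhammer_rec[of "1 :: complex" n] by (simp add: pochhammer_fact[symmetric])
  \<comment> \<open>Shifting the index pulls out the first factors; they combine to the constant 8/3
    = (1/2) / ((1/4) * (3/4)).\<close>
  have rec: "pochhammer (1/4) (Suc n) = 1/4 * pochhammer (5/4 :: complex) n"
    "pochhammer (3/4) (Suc n) = 3/4 * pochhammer (7/4 :: complex) n"
    "pochhammer (1/2) (Suc n) = 1/2 * pochhammer (3/2 :: complex) n"
    by (simp_all add: pochhammer_rec)
  have nz: "pochhammer (5/4 :: complex) n \<noteq> 0" "pochhammer (7/4 :: complex) n \<noteq> 0"
      "pochhammer (3/2 :: complex) n \<noteq> 0"
    by (rule pochhammer_nonzero_of_Re_pos; simp)+
  have nz': "(of_nat (Suc n) :: complex) \<noteq> 0"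
    by (rule of_nat_neq_0)
  have fact: "fact (Suc n) = (of_nat (Suc n) * fact n :: complex)"
    by (rule fact_Suc)
  have x: "x ^ (2 * Suc n) = x\<^sup>2 * (x\<^sup>2) ^ n"
    by (simp only: power_mult power_Suc)
  show ?thesis
    unfolding E4_term_def hypergeo_4F3_term_def diff_Suc_1 prod binomial_4n_2n_pochhammer rec two fact
      pochhammer_fact[symmetric] x
    using nz nz' by (simp add: power2_eq_square divide_simps del: of_nat_Suc)
qed

section \<open>The binomial series of the square root\<close>

text \<open>Makes the sign explicit: after the constant term the coefficients alternate, starting
  positive.\<close>

lemma half_gchoose_Suc:
  "((1/2 :: real) gchoose Suc k) = (-1) ^ k * pochhammer (1/2) k / (2 * fact (Suc k))"
  by (simp add: gbinomial_pochhammer pochhammer_rec)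

lemma summable_norm_half_gchoose: "summable (\<lambda>k. norm ((1/2 :: real) gchoose k))"
proof (rule summableI_nonneg_bounded)
  fix m
  let ?a = "\<lambda>k. (1/2 :: real) gchoose k"
  \<comment> \<open>By alternation the absolute value is \<open>- ?a k * (-1) ^ k\<close> for
    positive \<open>k\<close>. At \<open>k = 0\<close> this would give -1 instead of 1, hence the
    correction 2.\<close>
  have abs: "norm (?a k) = (if k = 0 then 2 else 0) - ?a k * (-1) ^ k" for k
  proof (cases k)
    case (Suc i)
    have "pochhammer (1/2 :: real) i \<ge> 0"
      by (intro less_imp_le pochhammer_pos) simp
    with Suc show ?thesis
      by (simp add: half_gchoose_Suc abs_mult power_mult_distrib[symmetric])
  qed simp
  \<comment> \<open>This is the closed form of the alternating partial sum up to \<open>m\<close>.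
    Its nonnegativity bounds the partial sums of absolute values by the correction 2.\<close>
  have "(-1) ^ m * (-1/2 gchoose m) = pochhammer (1/2 :: real) m / fact m"
    by (simp add: gbinomial_pochhammer power_mult_distrib[symmetric])
  also have "\<dots> \<ge> 0"
    by (intro divide_nonneg_nonneg less_imp_le pochhammer_pos) simp_all
  finally have pos: "(-1) ^ m * (-1/2 gchoose m) \<ge> (0 :: real)" .
  have "(\<Sum>k<m. norm (?a k)) \<le> (\<Sum>k\<le>m. norm (?a k))"
    by (intro sum_mono2) auto
  also have "\<dots> = 2 - (\<Sum>k\<le>m. ?a k * (-1) ^ k)"
    by (simp only: abs sum_subtractf) simp
  also have "\<dots> = 2 - (-1) ^ m * (-1/2 gchoose m)"
    by (simp add: gbinomial_sum_lower_neg)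
  finally show "(\<Sum>k<m. norm (?a k)) \<le> 2"
    using pos by linarith
qed auto

lemma half_gchoose_series_power2:
  fixes y :: real
  assumes "\<bar>y\<bar> = 1"
  shows "(\<Sum>k. (1/2 gchoose k) * y ^ k)\<^sup>2 = 1 + y"
proof -
  let ?a = "\<lambda>k. (1/2 gchoose k) * y ^ k"
  have "summable (\<lambda>k. norm (?a k))"
    using summable_norm_half_gchoose assms by (simp add: abs_mult power_abs)
  from Cauchy_product[OF this this]
  have "(\<Sum>k. ?a k)\<^sup>2 = (\<Sum>k. \<Sum>i\<le>k. ?a i * ?a (k - i))"
    by (simp add: power2_eq_square)
  also have "(\<lambda>k. \<Sum>i\<le>k. ?a i * ?a (k - i)) = (\<lambda>k. (1 gchoose k) * y ^ k)"
  proof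
    fix k
    have "(\<Sum>i\<le>k. ?a i * ?a (k - i)) = (\<Sum>i\<le>k. (1/2 gchoose i) * (1/2 gchoose (k - i)) * y ^ k)"
      by (intro sum.cong refl) (simp add: mult_ac flip: power_add)
    also have "\<dots> = (1 gchoose k) * y ^ k"
      using gbinomial_Vandermonde[of "1/2 :: real" "1/2" k]
      by (simp add: atMost_atLeast0 flip: sum_distrib_right)
    finally show "(\<Sum>i\<le>k. ?a i * ?a (k - i)) = (1 gchoose k) * y ^ k" .
  qed
  \<comment> \<open>Vandermonde has turned the exponent 1/2 + 1/2 into 1, so the series is a
    polynomial of degree 1.\<close>
  also have "(\<Sum>k. (1 gchoose k) * y ^ k) = (\<Sum>k<2. (1 gchoose k) * y ^ k)"
  proof (rule suminf_finite)
    fix k :: nat assume "k \<notin> {..<2}"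
    then have "(1 :: nat) choose k = 0" by simp
    then show "(1 gchoose k) * y ^ k = 0"
      by (metis binomial_gbinomial mult_zero_left of_nat_0 of_nat_1)
  qed simp
  also have "\<dots> = 1 + y"
    by (simp add: numeral_2_eq_2)
  finally show ?thesis .
qed

lemma sums_sqrt_2:
  "(\<lambda>n. real ((4 * n) choose (2 * n)) / (16 ^ n * (2 * real n + 1))) sums sqrt 2"
proof -
  let ?a = "\<lambda>k. (1/2 :: real) gchoose k"
  let ?t = "\<lambda>n. real ((4 * n) choose (2 * n)) / (16 ^ n * (2 * real n + 1))"
  have t: "2 * ?a (2 * n + 1) = ?t n" for n
    using central_binomial_pochhammer[of "2 * n", where 'a = real]
    by (simp add: half_gchoose_Suc power_mult add_ac)
  \<comment> \<open>Subtracting the series at -1 from the series at 1 cancels even indices and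
    doubles odd ones.\<close>
  define f where "f k = ?a k - ?a k * (-1) ^ k" for k
  have abs: "summable ?a" "summable (\<lambda>k. ?a k * (-1) ^ k)"
    by (rule summable_norm_cancel, use summable_norm_half_gchoose in \<open>simp add: abs_mult\<close>)+
  define A B where "A = (\<Sum>k. ?a k)" and "B = (\<Sum>k. ?a k * (-1) ^ k)"
  have "f sums (A - B)"
    unfolding f_def A_def B_def using abs by (intro sums_diff summable_sums)
  moreover have A2: "A\<^sup>2 = 2" and B: "B = 0"
    using half_gchoose_series_power2[of 1] half_gchoose_series_power2[of "-1"]
    by (simp_all add: A_def B_def)
  ultimately have "f sums A" by simp
  \<comment> \<open>Since \<open>f\<close> vanishes at even indices, summing over odd indices alone
    keeps the value.\<close>
  moreover have "(\<lambda>n. f (2 * n + 1)) sums A \<longleftrightarrow> f sums A"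
  proof (rule sums_mono_reindex)
    show "strict_mono (\<lambda>n :: nat. 2 * n + 1)"
      by (simp add: strict_mono_def)
    fix k assume "k \<notin> range (\<lambda>n :: nat. 2 * n + 1)"
    then have "even k" by (metis oddE rangeI)
    then show "f k = 0" by (simp add: f_def)
  qed
  moreover have "f (2 * n + 1) = ?t n" for n
    using t[of n] by (simp add: f_def)
  ultimately have sums: "?t sums A" by simp
  \<comment> \<open>\<open>A\<^sup>2 = 2\<close> leaves the sign open; the nonnegative summands
    \<open>?t n\<close> select the positive root.\<close>
  then have "A \<ge> 0"
    by (rule sums_le[OF _ sums_zero, rotated]) simp
  with A2 have "A = sqrt 2"
    by (simp add: real_sqrt_unique)
  with sums show ?thesis by simp
qed

theorem theoremB1:
  fixes z \<alpha> :: complex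
  assumes "\<alpha>\<^sup>2 = z"
  shows
    "(\<forall>x::complex. norm x < 1 \<longrightarrow>
        summable (O4_term z x) \<and>
        summable (hypergeo_4F3_term (1/4) (3/4) (1/2 + \<i> * \<alpha> / 2) (1/2 - \<i> * \<alpha> / 2)
                    (1/2) (1/2) (3/2) (x\<^sup>2)) \<and>
        O4 z x = x * hypergeo_4F3 (1/4) (3/4) (1/2 + \<i> * \<alpha> / 2) (1/2 - \<i> * \<alpha> / 2)
                       (1/2) (1/2) (3/2) (x\<^sup>2))
     \<and> (\<forall>x::complex. norm x < 1 \<longrightarrow>
        summable (\<lambda>n. E4_term z x (Suc n)) \<and>
        summable (hypergeo_4F3_term 1 (3/2) (1 + \<i> * \<alpha>) (1 - \<i> * \<alpha>)
                    2 (5/4) (7/4) (x\<^sup>2)) \<and>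
        E4 z x = 8/3 * x\<^sup>2 * hypergeo_4F3 1 (3/2) (1 + \<i> * \<alpha>) (1 - \<i> * \<alpha>)
                                2 (5/4) (7/4) (x\<^sup>2))
     \<and> summable (O4_term 0 1)
     \<and> O4 0 1 = complex_of_real
          (\<Sum>n. real ((4 * n) choose (2 * n)) / (16 ^ n * (2 * real n + 1)))
     \<and> (\<lambda>n. real ((4 * n) choose (2 * n)) / (16 ^ n * (2 * real n + 1))) sums sqrt 2"
proof -
  let ?t = "\<lambda>n. real ((4 * n) choose (2 * n)) / (16 ^ n * (2 * real n + 1))"
  \<comment> \<open>At \<open>z = 0\<close> every factor of the product is 1, so the terms are real
    and the real sum transfers.\<close>
  have t: "O4_term 0 1 = (\<lambda>n. complex_of_real (?t n))"
    by (simp add: O4_term_def fun_eq_iff)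
  have "O4_term 0 1 sums complex_of_real (\<Sum>n. ?t n)"
    unfolding t using sums_sqrt_2 by (intro sums_of_real summable_sums sums_summable)
  then have "summable (O4_term 0 1)" "O4 0 1 = complex_of_real (\<Sum>n. ?t n)"
    by (simp_all add: O4_def sums_iff)
  moreover have "norm (x\<^sup>2) < 1" if "norm x < 1" for x :: complex
    using that by (simp add: norm_power power_less_one_iff)
  note summable_hypergeo_4F3_term[OF this]
  \<comment> \<open>Convergence and value of both series pass from the hypergeometric ones through
    the constant factors \<open>x\<close> and \<open>8/3 * x\<^sup>2\<close>.\<close>
  ultimately show ?thesis
    using sums_sqrt_2
    by (simp add: O4_def E4_def hypergeo_4F3_def O4_term_eq[OF assms, abs_def]
        E4_term_Suc_eq[OF assms] summable_mult suminf_mult del: times_divide_eq_left)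
qed

end
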